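(* Let $D$ be an HHR domain in a complex Banach space $V$. Then $D$ is a domain of holomorphy.
   Context: All Banach and Hilbert spaces are over $\mathbb{C}$. A domain is a nonempty connected open set. For a Hilbert space $H$, $B_H=\{x\in H:\|x\|<1\}$ is the open unit ball (a Hilbert ball), and $rB_H=\{x\in H:\|x\|<r\}$. A map $f:D_1\to D_2$ between domains is a holomorphic embedding if $f(D_1)$ is a domain in $D_2$ and $f$ is biholomorphic onto $f(D_1)$. For a bounded domain $D$ in a Banach space $V$, $H(D,B_H)$ denotes the set of holomorphic embeddings of $D$ into $B_H$. It is nonempty if and only if $V$ is linearly homeomorphic to $H$. If $H(D,B_H)\neq\emptyset$, the squeezing function $\sigma_D:D\to(0,1]$ is $$\sigma_D(p)=\sup\{r>0:\ rB_H\subset f(D)\text{ for some } f\in H(D,B_H)\text{ with } f(p)=0\}$$ (it does not depend on the choice of $H$), and the squeezing constant is $\hat\sigma_D=\inf_{p\in D}\sigma_D(p)$. A bounded domain $D$ in a complex Banach space is called holomorphic homogeneous regular (HHR) if it admits a holomorphic embedding into some Hilbert ball $B_H$ and $\hat\sigma_D>0$. A domain $D\subset V$ is a domain of holomorphy if there do not exist open sets $U,W\subset V$ such that: (i) $U$ is connected; (ii) $D\cap U\neq\emptyset$; (iii) $U\not\subset D$; (iv) $\emptyset\neq W\subset D\cap U$; (v) for each holomorphic $f:D\to\mathbb{C}$ there is a holomorphic $\tilde f:U\to\mathbb{C}$ with $\tilde f=f$ on $W$. *)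

theory Defs
  imports "HOL-Analysis.Analysis"
begin

section \<open>Complex Banach and Hilbert spaces\<close>

text \<open>Complex spaces extend the real classes of the library, so that topology, \<open>norm\<close>,
  \<open>has_derivative\<close> etc. are the library's own; the first axiom ties the two scalar
  multiplications together.\<close>

class complex_normed_vector = real_normed_vector +
  fixes scaleC :: "complex \<Rightarrow> 'a \<Rightarrow> 'a"  (infixr "*\<^sub>C" 75)
  assumes scaleR_scaleC: "r *\<^sub>R x = complex_of_real r *\<^sub>C x"
    and scaleC_add_right: "a *\<^sub>C (x + y) = a *\<^sub>C x + a *\<^sub>C y"
    and scaleC_add_left: "(a + b) *\<^sub>C x = a *\<^sub>C x + b *\<^sub>C x"
    and scaleC_scaleC: "a *\<^sub>C (b *\<^sub>C x) = (a * b) *\<^sub>C x"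
    and norm_scaleC: "norm (a *\<^sub>C x) = cmod a * norm x"

class complex_banach = complex_normed_vector + banach

text \<open>The inner product is linear in the first argument. The last axiom says at once that
  \<open>cinner x x\<close> is real, that the form is positive definite, and that it induces the norm.\<close>

class complex_inner = complex_normed_vector +
  fixes cinner :: "'a \<Rightarrow> 'a \<Rightarrow> complex"
  assumes cinner_commute: "cinner x y = cnj (cinner y x)"
    and cinner_add_left: "cinner (x + y) z = cinner x z + cinner y z"
    and cinner_scaleC_left: "cinner (a *\<^sub>C x) y = a * cinner x y"
    and cinner_self: "cinner x x = complex_of_real ((norm x)\<^sup>2)"

class complex_hilbert = complex_inner + complex_banach

instantiation complex :: complex_hilbert
begin

definition scaleC_complex :: "complex \<Rightarrow> complex \<Rightarrow> complex"
  where "scaleC_complex a x = a * x"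

definition cinner_complex :: "complex \<Rightarrow> complex \<Rightarrow> complex"
  where "cinner_complex x y = x * cnj y"

instance
proof
  fix x :: complex
  show "cinner x x = complex_of_real ((norm x)\<^sup>2)"
    by (simp only: cinner_complex_def complex_norm_square)
qed (simp_all add: scaleC_complex_def cinner_complex_def scaleR_conv_of_real
      ring_distribs mult.assoc norm_mult)

end


section \<open>Holomorphic maps\<close>

definition is_domain :: "'a::topological_space set \<Rightarrow> bool"
  where "is_domain D \<longleftrightarrow> D \<noteq> {} \<and> connected D \<and> open D"

text \<open>Holomorphy means complex Frechet differentiability: the real Frechet derivative exists
  and is complex linear. The notion is only used for open \<open>S\<close>; values of \<open>f\<close> outside \<open>S\<close> are
  then irrelevant.\<close>

definition holomorphic_map_on ::
    "('a::complex_normed_vector \<Rightarrow> 'b::complex_normed_vector) \<Rightarrow> 'a set \<Rightarrow> bool"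
    (infixl "holomorphic'_map'_on" 50)
  where "f holomorphic_map_on S \<longleftrightarrow>
    (\<forall>x\<in>S. \<exists>f'. (f has_derivative f') (at x) \<and> (\<forall>c v. f' (c *\<^sub>C v) = c *\<^sub>C f' v))"

lemma holomorphic_map_on_complex_iff:
  fixes f :: "complex \<Rightarrow> complex"
  assumes "open S"
  shows "f holomorphic_map_on S \<longleftrightarrow> f holomorphic_on S"
proof -
  have "(\<exists>f'. (f has_derivative f') (at x) \<and> (\<forall>c v. f' (c *\<^sub>C v) = c *\<^sub>C f' v)) \<longleftrightarrow>
      f field_differentiable at x" (is "?L \<longleftrightarrow> ?R") for x
  proof
    assume ?L
    then obtain f' where f': "(f has_derivative f') (at x)" "\<And>c v. f' (c * v) = c * f' v"
      by (auto simp: scaleC_complex_def)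
    have "f' c = f' 1 * c" for c
    proof -
      have "f' c = f' (c * 1)" by (simp only: mult_1_right)
      also have "\<dots> = c * f' 1" by (rule f'(2))
      also have "\<dots> = f' 1 * c" by (rule mult.commute)
      finally show ?thesis .
    qed
    then have "f' = (*) (f' 1)"
      by (rule ext)
    with f'(1) have "(f has_field_derivative f' 1) (at x)"
      by (simp add: has_field_derivative_def)
    then show ?R
      by (auto simp: field_differentiable_def)
  next
    assume ?R
    then obtain d where "(f has_derivative (*) d) (at x)"
      by (auto simp: field_differentiable_def has_field_derivative_def)
    then show ?L
      by (intro exI[of _ "(*) d"]) (simp add: scaleC_complex_def)
  qed
  then have "f holomorphic_map_on S \<longleftrightarrow> (\<forall>x\<in>S. f field_differentiable at x)"
    unfolding holomorphic_map_on_def by (rule ball_cong[OF refl])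
  also have "\<dots> \<longleftrightarrow> f holomorphic_on S"
    unfolding holomorphic_on_def
    by (rule ball_cong[OF refl]) (simp only: at_within_open[OF _ assms])
  finally show ?thesis .
qed

definition biholomorphic_onto ::
    "('a::complex_normed_vector \<Rightarrow> 'b::complex_normed_vector) \<Rightarrow> 'a set \<Rightarrow> 'b set \<Rightarrow> bool"
  where "biholomorphic_onto f A B \<longleftrightarrow>
    bij_betw f A B \<and> f holomorphic_map_on A \<and> inv_into A f holomorphic_map_on B"

definition holomorphic_embedding ::
    "('a::complex_normed_vector \<Rightarrow> 'b::complex_normed_vector) \<Rightarrow> 'a set \<Rightarrow> 'b set \<Rightarrow> bool"
  where "holomorphic_embedding f D\<^sub>1 D\<^sub>2 \<longleftrightarrow>
    is_domain (f ` D\<^sub>1) \<and> f ` D\<^sub>1 \<subseteq> D\<^sub>2 \<and> biholomorphic_onto f D\<^sub>1 (f ` D\<^sub>1)"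


section \<open>Squeezing function and HHR domains\<close>

text \<open>The Hilbert space \<open>H\<close> is the type \<open>'h\<close>, and \<open>r B\<^sub>H\<close> is \<open>ball 0 r\<close>.\<close>

definition ball_embeddings ::
    "'a::complex_banach set \<Rightarrow> ('a \<Rightarrow> 'h::complex_hilbert) set"
  where "ball_embeddings D = {f. holomorphic_embedding f D (ball 0 1)}"

text \<open>The supremum is over a set bounded by \<open>1\<close> unless \<open>'h\<close> is the zero space, in which case
  the value is unspecified.\<close>

definition squeezing_function ::
    "'h::complex_hilbert itself \<Rightarrow> 'a::complex_banach set \<Rightarrow> 'a \<Rightarrow> real"
  where "squeezing_function H D p =
    Sup {r. r > 0 \<and> (\<exists>f\<in>ball_embeddings D. f p = (0::'h) \<and> ball 0 r \<subseteq> f ` D)}"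

definition squeezing_constant ::
    "'h::complex_hilbert itself \<Rightarrow> 'a::complex_banach set \<Rightarrow> real"
  where "squeezing_constant H D = (INF p\<in>D. squeezing_function H D p)"

text \<open>HOL cannot quantify existentially over the type \<open>'h\<close>, so HHR carries the Hilbert space
  as a parameter: \<open>D\<close> is HHR iff \<open>HHR TYPE('h) D\<close> holds for some Hilbert space \<open>'h\<close>. As a
  hypothesis of a theorem polymorphic in \<open>'h\<close>, this is the unparametrised notion.\<close>

definition HHR :: "'h::complex_hilbert itself \<Rightarrow> 'a::complex_banach set \<Rightarrow> bool"
  where "HHR H D \<longleftrightarrow> is_domain D \<and> bounded D \<and>
    (ball_embeddings D :: ('a \<Rightarrow> 'h) set) \<noteq> {} \<and> squeezing_constant H D > 0"


section \<open>Domains of holomorphy\<close>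

definition domain_of_holomorphy :: "'a::complex_banach set \<Rightarrow> bool"
  where "domain_of_holomorphy D \<longleftrightarrow> is_domain D \<and>
    \<not> (\<exists>U W. open U \<and> open W \<and> connected U \<and> D \<inter> U \<noteq> {} \<and> \<not> U \<subseteq> D \<and>
        W \<noteq> {} \<and> W \<subseteq> D \<inter> U \<and>
        (\<forall>f::'a \<Rightarrow> complex. f holomorphic_map_on D \<longrightarrow>
          (\<exists>g::'a \<Rightarrow> complex. g holomorphic_map_on U \<and> (\<forall>x\<in>W. g x = f x))))"

end

theory Submission
  imports Defs "HOL-Complex_Analysis.Conformal_Mappings"
begin

text \<open>
  Suppose that every holomorphic function on \<open>D\<close> continues from \<open>W\<close> to \<open>U\<close>, and let \<open>\<Omega>\<close> be a
  component of \<open>D \<inter> U\<close> that meets \<open>W\<close>. By the identity theorem the continuation of a function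
  agrees with it on all of \<open>\<Omega>\<close>. As \<open>U\<close> is connected and not contained in \<open>D\<close>, some point \<open>q\<close> of
  \<open>U\<close> outside \<open>\<Omega>\<close> is a limit of points of \<open>\<Omega>\<close>. Fix a ball of radius \<open>2R\<close> about \<open>q\<close> inside \<open>U\<close>,
  and consider \<open>p \<in> \<Omega>\<close> close to \<open>q\<close>.

  HHR provides an embedding \<open>f\<close> of \<open>D\<close> into the unit ball with \<open>f p = 0\<close> whose image contains a ball
  of radius \<open>r\<close>, where \<open>r\<close> does not depend on \<open>p\<close>. The proof plays two facts against each other.

  \<^item> Continuation preserves the bound 1 (\<open>extension_bounded\<close>), so each function \<open>\<langle>f x, e\<rangle>\<close> with \<open>\<parallel>e\<parallel> \<le> 1\<close>
    becomes a function bounded by 1 on the ball of radius \<open>R\<close> about \<open>p\<close>. The Schwarz lemma makes it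
    Lipschitz with constant \<open>4/R\<close> on half of that ball, and optimising over \<open>e\<close> makes \<open>f\<close> itself
    \<open>4/R\<close>-Lipschitz on the part of \<open>\<Omega>\<close> there. No vector-valued continuation has to be built.

  \<^item> The inverse of \<open>f\<close> is defined and continuous on \<open>ball 0 r\<close>. Therefore a sequence in \<open>\<Omega>\<close> that
    approaches a point at distance less than \<open>min (R/2) (r R/4)\<close> from \<open>p\<close> has images converging to
    a point of \<open>ball 0 r\<close>, and its limit is the preimage of that point; it cannot leave \<open>D\<close>
    (\<open>ball_subset_if_lipschitz\<close>).

  Hence \<open>\<Omega>\<close> contains a ball about \<open>p\<close> whose radius is independent of \<open>p\<close>. When \<open>p\<close> is close enough
  to \<open>q\<close> this ball contains \<open>q\<close>, a contradiction.
\<close>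

section \<open>Complex normed and inner product spaces\<close>

lemma bounded_linear_scaleC_left: "bounded_linear (\<lambda>c. c *\<^sub>C (v::'a::complex_normed_vector))"
proof (rule bounded_linear_intro[where K = "norm v"])
  show "(r *\<^sub>R x) *\<^sub>C v = r *\<^sub>R x *\<^sub>C v" for r x
    by (simp add: scaleR_scaleC[of r "x *\<^sub>C v"] scaleC_scaleC scaleR_conv_of_real)
qed (simp_all add: scaleC_add_left norm_scaleC)

lemma scaleC_one: "1 *\<^sub>C v = (v::'a::complex_normed_vector)"
  using scaleR_scaleC[of 1 v] by simp

lemma scaleC_zero_left: "0 *\<^sub>C v = (0::'a::complex_normed_vector)"
  using scaleR_scaleC[of 0 v] by simp

lemma scaleC_scaleR_commute: "c *\<^sub>C (r *\<^sub>R v) = r *\<^sub>R c *\<^sub>C (v::'a::complex_normed_vector)"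
  by (simp add: scaleR_scaleC scaleC_scaleC mult.commute)

lemma cinner_zero_left: "cinner 0 (y::'a::complex_inner) = 0"
  using cinner_add_left[of 0 0 y] by simp

lemma cinner_diff_left: "cinner (x - y) z = cinner x z - cinner y (z::'a::complex_inner)"
  using cinner_add_left[of "x - y" y z] by simp

lemma cinner_add_right: "cinner x (y + z) = cinner x y + cinner x (z::'a::complex_inner)"
  by (metis cinner_add_left cinner_commute complex_cnj_add)

lemma cinner_scaleC_right: "cinner x (a *\<^sub>C y) = cnj a * cinner x (y::'a::complex_inner)"
  by (metis cinner_scaleC_left cinner_commute complex_cnj_mult)

lemma cinner_cauchy_schwarz: "cmod (cinner x y) \<le> norm x * norm (y::'a::complex_inner)"
proof (cases "y = 0")
  case True
  then show ?thesis
    using cinner_zero_left[of x] cinner_commute[of x y] by simp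
next
  case False
  define n where "n = (norm y)\<^sup>2"
  have n: "n > 0" using False by (simp add: n_def)
  define p where "p = cinner x y"
  define a where "a = - p / of_real n"
  \<comment> \<open>the component of \<open>x\<close> orthogonal to \<open>y\<close>\<close>
  define z where "z = x + a *\<^sub>C y"
  have "cinner z z = cinner x x + cnj a * p + a * cnj p + a * cnj a * cinner y y"
    using cinner_commute[of y x]
    by (simp add: z_def cinner_add_left cinner_add_right cinner_scaleC_left cinner_scaleC_right
        p_def algebra_simps)
  also have "\<dots> = cinner x x + cnj a * p + a * cnj p + a * cnj a * of_real n"
    by (simp only: cinner_self n_def)
  also have "\<dots> = cinner x x - p * cnj p / of_real n"
    using n by (simp add: a_def field_simps)
  also have "\<dots> = of_real ((norm x)\<^sup>2 - (cmod p)\<^sup>2 / n)"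
    by (simp add: cinner_self flip: complex_norm_square)
  finally have "(norm z)\<^sup>2 = (norm x)\<^sup>2 - (cmod p)\<^sup>2 / n"
    unfolding cinner_self of_real_eq_iff .
  then have "(cmod p)\<^sup>2 / n \<le> (norm x)\<^sup>2"
    using zero_le_power2[of "norm z"] by linarith
  then have "(cmod p)\<^sup>2 \<le> (norm x * norm y)\<^sup>2"
    using n by (simp add: n_def power_mult_distrib field_simps)
  then show ?thesis
    unfolding p_def by (rule power2_le_imp_le) simp
qed

lemma bounded_linear_cinner_left: "bounded_linear (\<lambda>x. cinner x (e::'a::complex_inner))"
proof (rule bounded_linear_intro[where K = "norm e"])
  show "cinner (r *\<^sub>R x) e = r *\<^sub>R cinner x e" for r x
    by (simp add: scaleR_scaleC[of r x] cinner_scaleC_left scaleR_conv_of_real)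
qed (simp_all add: cinner_add_left cinner_cauchy_schwarz)

text \<open>A vector is normed by its own direction, so a bound on all scalar components gives a bound on
  the vector.\<close>

lemma norm_le_if_cinner_le:
  fixes x :: "'a::complex_inner"
  assumes "\<And>e. norm e \<le> 1 \<Longrightarrow> cmod (cinner x e) \<le> B" and "B \<ge> 0"
  shows "norm x \<le> B"
proof (cases "x = 0")
  case False
  define e where "e = (1 / norm x) *\<^sub>R x"
  have "cinner x e = of_real (norm x)"
    using False
    by (simp add: e_def scaleR_scaleC[of _ x] cinner_scaleC_right cinner_self power2_eq_square)
  moreover have "norm e \<le> 1" by (simp add: e_def)
  ultimately show ?thesis using assms(1)[of e] by simp
qed (use assms in simp)


section \<open>Holomorphic maps between normed spaces\<close>

lemma holomorphic_map_on_subset: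
  "f holomorphic_map_on S \<Longrightarrow> T \<subseteq> S \<Longrightarrow> f holomorphic_map_on T"
  by (auto simp: holomorphic_map_on_def)

lemma holomorphic_map_on_imp_isCont:
  "f holomorphic_map_on S \<Longrightarrow> x \<in> S \<Longrightarrow> isCont f x"
  by (auto simp: holomorphic_map_on_def intro: has_derivative_continuous)

lemma holomorphic_map_on_cong:
  assumes "f holomorphic_map_on S" and "open S" and "\<And>x. x \<in> S \<Longrightarrow> f x = g x"
  shows "g holomorphic_map_on S"
  unfolding holomorphic_map_on_def
proof
  fix x assume x: "x \<in> S"
  then obtain f' where "(f has_derivative f') (at x)" "\<forall>c v. f' (c *\<^sub>C v) = c *\<^sub>C f' v"
    using assms(1) by (auto simp: holomorphic_map_on_def)
  moreover from this(1) have "(g has_derivative f') (at x)"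
    using assms(2) x assms(3) by (rule has_derivative_transform_within_open)
  ultimately show "\<exists>f'. (g has_derivative f') (at x) \<and> (\<forall>c v. f' (c *\<^sub>C v) = c *\<^sub>C f' v)"
    by blast
qed

lemma holomorphic_map_on_compose:
  assumes "f holomorphic_map_on S" and "g holomorphic_map_on T" and "f ` S \<subseteq> T"
  shows "(\<lambda>x. g (f x)) holomorphic_map_on S"
  unfolding holomorphic_map_on_def
proof
  fix x assume x: "x \<in> S"
  obtain f' where f': "(f has_derivative f') (at x)" "\<forall>c v. f' (c *\<^sub>C v) = c *\<^sub>C f' v"
    using assms(1) x by (auto simp: holomorphic_map_on_def)
  obtain g' where g': "(g has_derivative g') (at (f x))" "\<forall>c v. g' (c *\<^sub>C v) = c *\<^sub>C g' v"
    using assms x by (force simp: holomorphic_map_on_def)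
  have "((\<lambda>x. g (f x)) has_derivative (\<lambda>v. g' (f' v))) (at x)"
    using has_derivative_compose[OF f'(1) g'(1)] .
  then show "\<exists>h'. ((\<lambda>x. g (f x)) has_derivative h') (at x) \<and> (\<forall>c v. h' (c *\<^sub>C v) = c *\<^sub>C h' v)"
    using f'(2) g'(2) by auto
qed

lemma holomorphic_map_on_affine:
  "(\<lambda>x. r *\<^sub>R x + (b::'a::complex_normed_vector)) holomorphic_map_on S"
  unfolding holomorphic_map_on_def
proof
  fix x :: 'a
  have "((\<lambda>x. r *\<^sub>R x + b) has_derivative (\<lambda>v. r *\<^sub>R v)) (at x)"
    by (auto intro!: derivative_eq_intros)
  then show "\<exists>f'. ((\<lambda>x. r *\<^sub>R x + b) has_derivative f') (at x)
      \<and> (\<forall>c v. f' (c *\<^sub>C v) = c *\<^sub>C f' v)"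
    by (intro exI[of _ "\<lambda>v. r *\<^sub>R v"]) (simp add: scaleC_scaleR_commute)
qed

lemma holomorphic_map_on_cinner:
  "(\<lambda>x. cinner x (e::'a::complex_inner)) holomorphic_map_on S"
  unfolding holomorphic_map_on_def
  by (intro ballI exI[of _ "\<lambda>x. cinner x e"])
    (simp add: bounded_linear_imp_has_derivative bounded_linear_cinner_left cinner_scaleC_left
      scaleC_complex_def)

lemma holomorphic_map_on_mult:
  fixes f g :: "'a::complex_normed_vector \<Rightarrow> complex"
  assumes "f holomorphic_map_on S" and "g holomorphic_map_on S"
  shows "(\<lambda>x. f x * g x) holomorphic_map_on S"
  unfolding holomorphic_map_on_def
proof
  fix x assume x: "x \<in> S"
  obtain f' where f': "(f has_derivative f') (at x)" "\<And>c v. f' (c *\<^sub>C v) = c * f' v"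
    using assms(1) x by (auto simp: holomorphic_map_on_def scaleC_complex_def)
  obtain g' where g': "(g has_derivative g') (at x)" "\<And>c v. g' (c *\<^sub>C v) = c * g' v"
    using assms(2) x by (auto simp: holomorphic_map_on_def scaleC_complex_def)
  show "\<exists>h'. ((\<lambda>x. f x * g x) has_derivative h') (at x) \<and> (\<forall>c v. h' (c *\<^sub>C v) = c *\<^sub>C h' v)"
    using has_derivative_mult[OF f'(1) g'(1)]
    by (intro exI[of _ "\<lambda>v. f x * g' v + f' v * g x"])
      (simp add: f'(2) g'(2) scaleC_complex_def algebra_simps)
qed

lemma holomorphic_map_on_diff:
  fixes f g :: "'a::complex_normed_vector \<Rightarrow> complex"
  assumes "f holomorphic_map_on S" and "g holomorphic_map_on S"
  shows "(\<lambda>x. f x - g x) holomorphic_map_on S"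
  unfolding holomorphic_map_on_def
proof
  fix x assume x: "x \<in> S"
  obtain f' where f': "(f has_derivative f') (at x)" "\<And>c v. f' (c *\<^sub>C v) = c * f' v"
    using assms(1) x by (auto simp: holomorphic_map_on_def scaleC_complex_def)
  obtain g' where g': "(g has_derivative g') (at x)" "\<And>c v. g' (c *\<^sub>C v) = c * g' v"
    using assms(2) x by (auto simp: holomorphic_map_on_def scaleC_complex_def)
  show "\<exists>h'. ((\<lambda>x. f x - g x) has_derivative h') (at x) \<and> (\<forall>c v. h' (c *\<^sub>C v) = c *\<^sub>C h' v)"
    using has_derivative_diff[OF f'(1) g'(1)]
    by (intro exI[of _ "\<lambda>v. f' v - g' v"])
      (simp add: f'(2) g'(2) scaleC_complex_def algebra_simps)
qed

lemma holomorphic_map_on_const: "(\<lambda>x. b :: complex) holomorphic_map_on S"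
  unfolding holomorphic_map_on_def
  by (intro ballI exI[of _ "\<lambda>_. 0"]) (simp add: scaleC_complex_def)

lemma holomorphic_on_slice:
  fixes h :: "'a::complex_normed_vector \<Rightarrow> complex"
  assumes "h holomorphic_map_on S" and "open T" and "\<And>t. t \<in> T \<Longrightarrow> a + t *\<^sub>C v \<in> S"
  shows "(\<lambda>t. h (a + t *\<^sub>C v)) holomorphic_on T"
proof -
  have "(\<lambda>t. a + t *\<^sub>C v) holomorphic_map_on T"
    unfolding holomorphic_map_on_def
  proof
    fix t :: complex
    have "((\<lambda>t. a + t *\<^sub>C v) has_derivative (\<lambda>t. 0 + t *\<^sub>C v)) (at t)"
      by (intro has_derivative_add has_derivative_const
          bounded_linear_imp_has_derivative bounded_linear_scaleC_left)
    then show "\<exists>f'. ((\<lambda>t. a + t *\<^sub>C v) has_derivative f') (at t)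
        \<and> (\<forall>c w. f' (c *\<^sub>C w) = c *\<^sub>C f' w)"
      by (intro exI[of _ "\<lambda>t. t *\<^sub>C v"]) (simp add: scaleC_complex_def scaleC_scaleC)
  qed
  then have "(\<lambda>t. h (a + t *\<^sub>C v)) holomorphic_map_on T"
    by (rule holomorphic_map_on_compose[OF _ assms(1)]) (use assms(3) in auto)
  then show ?thesis
    using holomorphic_map_on_complex_iff assms(2) by blast
qed


section \<open>The identity theorem and bounds for continuations\<close>

lemma connected_eq_if_clopen:
  assumes "connected S" and "open A" and "A \<noteq> {}" and "A \<subseteq> S" and "S \<inter> closure A \<subseteq> A"
  shows "A = S"
proof -
  have "A = S \<inter> closure A" using assms(4,5) closure_subset by blast
  then have "closedin (top_of_set S) A"
    by (metis closed_closure closedin_closed_Int)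
  moreover have "openin (top_of_set S) A"
    using assms(2,4) by (simp add: open_subset)
  ultimately show ?thesis
    using assms(1,3) by (auto simp: connected_clopen)
qed

lemma zero_on_ball_if_zero_near_centre:
  fixes h :: "'a::complex_normed_vector \<Rightarrow> complex"
  assumes h: "h holomorphic_map_on ball a r" and A: "open A" "a \<in> A" "\<And>x. x \<in> A \<Longrightarrow> h x = 0"
    and y: "y \<in> ball a r"
  shows "h y = 0"
proof (cases "y = a")
  case False
  define v where "v = y - a"
  have v: "norm v > 0" "norm v < r"
    using False y by (auto simp: v_def dist_norm norm_minus_commute)
  obtain e where e: "e > 0" "ball a e \<subseteq> A"
    using A openE by blast
  define d where "d = min 1 (e / norm v)"
  have d: "d > 0" "d \<le> 1" "d \<le> e / norm v" using e v by (auto simp: d_def)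
  let ?T = "ball (0::complex) (r / norm v)"
  have hol: "(\<lambda>t. h (a + t *\<^sub>C v)) holomorphic_on ?T"
    using v by (intro holomorphic_on_slice[OF h]) (auto simp: dist_norm norm_scaleC field_simps)
  have r: "r / norm v > 1" using v by simp
  have "(\<lambda>t. h (a + t *\<^sub>C v)) 1 = (\<lambda>_. 0) 1"
  proof (rule analytic_continuation_open
      [of "ball 0 d" ?T "\<lambda>t. h (a + t *\<^sub>C v)" "\<lambda>_. 0"])
    show "ball 0 d \<subseteq> ?T" using d(2) r by (intro subset_ball) linarith
    fix t :: complex assume "t \<in> ball 0 d"
    then have "norm t * norm v < e"
      using d(3) v(1) less_le_trans[of "norm t" d "e / norm v"] by (simp add: pos_less_divide_eq)
    then have "a + t *\<^sub>C v \<in> ball a e" by (simp add: dist_norm norm_scaleC)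
    then show "h (a + t *\<^sub>C v) = 0" using e A(3) by blast
  qed (use hol d(1) r in auto)
  then show ?thesis by (simp add: scaleC_one v_def)
qed (use A in simp)

text \<open>The interior of the zero set of \<open>f - g\<close> is closed in \<open>U\<close>: a limit point lies in a ball around
  some interior zero, and restricting to complex lines through that zero reduces the question to
  one variable.\<close>

theorem identity_theorem:
  fixes f g :: "'a::complex_normed_vector \<Rightarrow> complex"
  assumes f: "f holomorphic_map_on U" and g: "g holomorphic_map_on U"
    and U: "open U" "connected U"
    and W: "open W" "W \<noteq> {}" "W \<subseteq> U" "\<And>x. x \<in> W \<Longrightarrow> f x = g x"
    and y: "y \<in> U"
  shows "f y = g y"
proof -
  define h where "h x = f x - g x" for x
  have h: "h holomorphic_map_on U"
    unfolding h_def using f g by (rule holomorphic_map_on_diff)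
  define A where "A = interior {x \<in> U. h x = 0}"
  have AU: "A \<subseteq> U" and A0: "\<And>x. x \<in> A \<Longrightarrow> h x = 0"
    using interior_subset[of "{x \<in> U. h x = 0}"] by (auto simp: A_def)
  have "A = U"
  proof (rule connected_eq_if_clopen)
    have "W \<subseteq> A" unfolding A_def using W by (intro interior_maximal) (auto simp: h_def)
    then show "A \<noteq> {}" using W(2) by blast
    show "U \<inter> closure A \<subseteq> A"
    proof
      fix x assume x: "x \<in> U \<inter> closure A"
      then obtain e where e: "e > 0" "ball x e \<subseteq> U" using U(1) openE by blast
      obtain a where a: "a \<in> A" "dist a x < e / 2"
        using x e(1) by (metis IntD2 closure_approachable half_gt_zero)
      have sub: "ball a (e / 2) \<subseteq> U"
      proof
        fix z assume "z \<in> ball a (e / 2)"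
        then have "dist x z < e"
          using a(2) dist_triangle_half_r[of a x e z] by simp
        then show "z \<in> U" using e by auto
      qed
      have "h z = 0" if "z \<in> ball a (e / 2)" for z
        using zero_on_ball_if_zero_near_centre[OF holomorphic_map_on_subset[OF h sub] _ a(1) A0 that]
        by (simp add: A_def)
      then have "ball a (e / 2) \<subseteq> A"
        unfolding A_def using sub by (intro interior_maximal) auto
      then show "x \<in> A" using a(2) by auto
    qed
  qed (use AU U in \<open>auto simp: A_def\<close>)
  then have "h y = 0" using A0 y by blast
  then show ?thesis by (simp add: h_def)
qed

text \<open>If the continuation \<open>G\<close> of \<open>\<phi>\<close> took a value \<open>c\<close> of modulus at least 1, the function
  \<open>1 / (\<phi> - c)\<close> would be holomorphic on \<open>D\<close>, and its continuation would still be inverse to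
  \<open>G - c\<close> on all of \<open>U\<close>, which is impossible at a zero of \<open>G - c\<close>.\<close>

lemma extension_bounded:
  fixes \<phi> G :: "'a::complex_normed_vector \<Rightarrow> complex"
  assumes ext: "\<And>f::'a \<Rightarrow> complex. f holomorphic_map_on D \<Longrightarrow>
      \<exists>g::'a \<Rightarrow> complex. g holomorphic_map_on U \<and> (\<forall>x\<in>W. g x = f x)"
    and U: "open U" "connected U" and W: "open W" "W \<noteq> {}" "W \<subseteq> U" "W \<subseteq> D"
    and \<phi>: "\<phi> holomorphic_map_on D" "\<And>x. x \<in> D \<Longrightarrow> cmod (\<phi> x) < 1"
    and G: "G holomorphic_map_on U" "\<And>x. x \<in> W \<Longrightarrow> G x = \<phi> x" and u: "u \<in> U"
  shows "cmod (G u) < 1"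
proof (rule ccontr)
  assume "\<not> cmod (G u) < 1"
  then have ne: "\<phi> x \<noteq> G u" if "x \<in> D" for x
    using \<phi>(2)[OF that] by auto
  have "(\<lambda>z. inverse (z - G u)) holomorphic_map_on - {G u}"
    by (subst holomorphic_map_on_complex_iff) (auto intro!: holomorphic_intros)
  then have "(\<lambda>x. inverse (\<phi> x - G u)) holomorphic_map_on D"
    by (rule holomorphic_map_on_compose[OF \<phi>(1)]) (rule image_subsetI, simp add: ne)
  then obtain K where K: "K holomorphic_map_on U" "\<And>x. x \<in> W \<Longrightarrow> K x = inverse (\<phi> x - G u)"
    using ext by blast
  have KG: "(\<lambda>x. K x * (G x - G u)) holomorphic_map_on U"
    by (intro holomorphic_map_on_mult holomorphic_map_on_diff holomorphic_map_on_const K(1) G(1))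
  have "K u * (G u - G u) = 1"
  proof (rule identity_theorem[OF KG holomorphic_map_on_const U W(1-3) _ u])
    show "K x * (G x - G u) = 1" if "x \<in> W" for x
      using that K(2) G(2) W(4) ne[of x] by auto
  qed
  then show False by simp
qed

text \<open>The Schwarz lemma applied to half the difference \<open>G - G a\<close>, which is bounded by 1 and
  vanishes at \<open>a\<close>, on the complex line through \<open>a\<close> and \<open>y\<close>.\<close>

lemma schwarz_difference:
  fixes G :: "'a::complex_normed_vector \<Rightarrow> complex"
  assumes G: "G holomorphic_map_on ball a R" "\<And>x. x \<in> ball a R \<Longrightarrow> cmod (G x) < 1"
    and y: "y \<in> ball a R"
  shows "cmod (G y - G a) \<le> 2 / R * dist a y"
proof (cases "y = a")
  case False
  have R: "R > 0" using y le_less_trans[OF zero_le_dist] by auto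
  define n where "n = norm (y - a)"
  have n: "n > 0" "n < R" using False y by (auto simp: n_def dist_norm norm_minus_commute)
  define v where "v = (R / n) *\<^sub>R (y - a)"
  have v: "norm v = R" using n R by (simp add: v_def flip: n_def)
  have inb: "a + t *\<^sub>C v \<in> ball a R" if "norm t < 1" for t
    using that R by (simp add: dist_norm norm_scaleC v)
  define F where "F t = (G (a + t *\<^sub>C v) - G a) / 2" for t
  have "(\<lambda>t. G (a + t *\<^sub>C v)) holomorphic_on ball 0 1"
    using inb by (intro holomorphic_on_slice[OF G(1)]) auto
  then have "F holomorphic_on ball 0 1"
    unfolding F_def by (auto intro!: holomorphic_intros)
  moreover have "F 0 = 0" by (simp add: F_def scaleC_zero_left)
  moreover have "norm (F t) < 1" if "norm t < 1" for t
  proof -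
    have "norm (G (a + t *\<^sub>C v)) < 1" "norm (G a) < 1"
      using G(2) inb[OF that] R by auto
    then show ?thesis
      unfolding F_def using norm_triangle_ineq4[of "G (a + t *\<^sub>C v)" "G a"]
      by (simp add: norm_divide)
  qed
  moreover have "norm (of_real (n / R) :: complex) < 1" using n R by (simp add: norm_divide)
  ultimately have "norm (F (of_real (n / R))) \<le> norm (of_real (n / R) :: complex)"
    by (rule Schwarz_Lemma(1))
  moreover have "of_real (n / R) *\<^sub>C v = y - a"
    using n R unfolding scaleR_scaleC[symmetric] by (simp add: v_def)
  ultimately have "cmod (G y - G a) / 2 \<le> n / R"
    using n R by (simp add: F_def norm_divide)
  then show ?thesis by (simp add: n_def dist_norm norm_minus_commute mult.commute)
qed simp

lemma lipschitz_half_ball: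
  fixes G :: "'a::complex_normed_vector \<Rightarrow> complex"
  assumes G: "G holomorphic_map_on ball p R" "\<And>x. x \<in> ball p R \<Longrightarrow> cmod (G x) < 1"
    and xy: "x \<in> ball p (R / 2)" "y \<in> ball p (R / 2)"
  shows "cmod (G x - G y) \<le> 4 / R * dist x y"
proof -
  have R: "R > 0" using xy(1) le_less_trans[OF zero_le_dist, of p x "R / 2"] by simp
  have sub: "ball y (R / 2) \<subseteq> ball p R"
  proof
    fix z assume "z \<in> ball y (R / 2)"
    then show "z \<in> ball p R"
      using xy(2) dist_triangle_half_r[of y p R z] by (simp add: dist_commute)
  qed
  show ?thesis
  proof (cases "dist y x < R / 2")
    case True
    have "cmod (G x - G y) \<le> 2 / (R / 2) * dist y x"
      using True sub G by (intro schwarz_difference holomorphic_map_on_subset[OF G(1) sub]) auto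
    then show ?thesis by (simp add: dist_commute)
  next
    case False
    \<comment> \<open>here the trivial bound \<open>2\<close> for the difference is good enough\<close>
    have "x \<in> ball p R" "y \<in> ball p R" using xy R by auto
    then have "cmod (G x - G y) \<le> 2"
      using G(2)[of x] G(2)[of y] norm_triangle_ineq4[of "G x" "G y"] by linarith
    also have "2 \<le> 4 / R * dist x y" using False R by (simp add: field_simps dist_commute)
    finally show ?thesis .
  qed
qed


section \<open>Uniform squeezing\<close>

text \<open>Translating an embedding so that a prescribed point goes to the origin costs a factor 2 in
  size. The radius of the ball covered this way depends on the point; it only shows that the
  supremum defining the squeezing function ranges over a nonempty set.\<close>

lemma centred_embedding_exists:
  fixes f :: "'a::complex_banach \<Rightarrow> 'h::complex_hilbert"
  assumes f: "f \<in> ball_embeddings D" and p: "p \<in> D"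
  shows "\<exists>r>0. \<exists>g\<in>ball_embeddings D. g p = (0::'h) \<and> ball 0 r \<subseteq> g ` D"
proof -
  define T where "T y = (1/2) *\<^sub>R y + (- (1/2) *\<^sub>R f p)" for y
  define S where "S y = 2 *\<^sub>R y + f p" for y
  have ST: "S (T y) = y" and TS: "T (S y) = y" for y
    by (simp_all add: S_def T_def scaleR_add_right scaleR_diff_right)
  define g where "g x = T (f x)" for x
  have dom: "is_domain (f ` D)" and sub: "f ` D \<subseteq> ball 0 1" and inj: "inj_on f D"
    and hol: "f holomorphic_map_on D" and invhol: "inv_into D f holomorphic_map_on f ` D"
    using f by (auto simp: ball_embeddings_def holomorphic_embedding_def biholomorphic_onto_def
        bij_betw_def)
  have img: "g ` D = T ` (f ` D)" by (auto simp: g_def)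
  have imgS: "g ` D = S -` (f ` D)"
    unfolding img using ST TS by (auto simp: image_iff) (metis TS)
  have contS: "continuous_on UNIV S" and contT: "continuous_on X T" for X
    by (auto simp: S_def[abs_def] T_def[abs_def] intro!: continuous_intros)
  have op: "open (g ` D)"
    unfolding imgS using contS dom by (intro open_vimage) (auto simp: is_domain_def)
  have "is_domain (g ` D)"
    using op dom connected_continuous_image[OF contT] p unfolding is_domain_def img by auto
  moreover have "g ` D \<subseteq> ball 0 1"
  proof -
    have "norm (g x) < 1" if "x \<in> D" for x
    proof -
      have "norm (f x) < 1" "norm (f p) < 1" using sub that p by auto
      moreover have "g x = (1/2) *\<^sub>R (f x - f p)" by (simp add: g_def T_def algebra_simps)
      ultimately show ?thesis using norm_triangle_ineq4[of "f x" "f p"] by simp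
    qed
    then show ?thesis by auto
  qed
  moreover have injg: "inj_on g D"
    unfolding g_def using inj ST by (intro inj_onI) (metis inj_onD)
  moreover have "g holomorphic_map_on D"
    unfolding g_def T_def
    by (rule holomorphic_map_on_compose[OF hol holomorphic_map_on_affine subset_UNIV])
  moreover have "inv_into D g holomorphic_map_on g ` D"
  proof (rule holomorphic_map_on_cong[OF _ op])
    show "(\<lambda>y. inv_into D f (S y)) holomorphic_map_on g ` D"
      unfolding S_def
    proof (rule holomorphic_map_on_compose[OF holomorphic_map_on_affine invhol])
      show "(\<lambda>y. 2 *\<^sub>R y + f p) ` g ` D \<subseteq> f ` D"
        unfolding imgS by (auto simp: S_def)
    qed
    show "inv_into D f (S y) = inv_into D g y" if "y \<in> g ` D" for y
      using that inj injg by (auto simp: g_def ST) (metis g_def inv_into_f_f)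
  qed
  ultimately have "g \<in> ball_embeddings D"
    by (simp add: ball_embeddings_def holomorphic_embedding_def biholomorphic_onto_def bij_betw_def)
  moreover have gp: "g p = 0" by (simp add: g_def T_def)
  moreover obtain r where "r > 0" "ball 0 r \<subseteq> g ` D"
    using op gp p by (metis imageI openE)
  ultimately show ?thesis by blast
qed

text \<open>The infimum over \<open>D\<close> bounds the squeezing function from below only if its values are bounded
  below. They are nonnegative unless \<open>'h\<close> is the zero space, where the suprema are taken over an
  unbounded set; but then \<open>D\<close>, which embeds into \<open>'h\<close>, is a single point.\<close>

lemma HHR_uniform_radius:
  fixes D :: "'a::complex_banach set"
  assumes "HHR TYPE('h::complex_hilbert) D"
  shows "\<exists>r>0. \<forall>p\<in>D. \<exists>f\<in>ball_embeddings D. f p = (0::'h) \<and> ball 0 r \<subseteq> f ` D"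
proof -
  define S where
    "S p = {r. r > 0 \<and> (\<exists>f\<in>ball_embeddings D. f p = (0::'h) \<and> ball 0 r \<subseteq> f ` D)}" for p
  define s where "s = squeezing_constant TYPE('h) D"
  have s: "s > 0" and s_eq: "s = (INF p\<in>D. Sup (S p))"
    using assms
    by (simp_all add: HHR_def s_def squeezing_constant_def squeezing_function_def S_def)
  obtain f\<^sub>0 :: "'a \<Rightarrow> 'h" where f\<^sub>0: "f\<^sub>0 \<in> ball_embeddings D"
    using assms by (auto simp: HHR_def)
  have S_ne: "S p \<noteq> {}" if "p \<in> D" for p
    using centred_embedding_exists[OF f\<^sub>0 that] by (auto simp: S_def)
  have bdd: "bdd_below ((\<lambda>p. Sup (S p)) ` D)"
  proof (cases "\<exists>y::'h. y \<noteq> 0")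
    case True
    then obtain y :: 'h where y: "y \<noteq> 0" by blast
    have le1: "r \<le> 1" if "r \<in> S p" for r p
    proof (rule ccontr)
      assume "\<not> r \<le> 1"
      then have "(1 / norm y) *\<^sub>R y \<in> ball 0 r" using y by simp
      moreover have "ball (0::'h) r \<subseteq> ball 0 1"
        using that by (auto simp: S_def ball_embeddings_def holomorphic_embedding_def)
      ultimately have "(1 / norm y) *\<^sub>R y \<in> ball 0 1" by blast
      then show False using y by simp
    qed
    show ?thesis
    proof (rule bdd_belowI2[where m = 0])
      fix p assume "p \<in> D"
      then obtain r where r: "r \<in> S p" using S_ne by blast
      then have "r \<le> Sup (S p)" using le1 by (intro cSup_upper bdd_aboveI[of _ 1]) auto
      then show "0 \<le> Sup (S p)" using r by (simp add: S_def)
    qed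
  next
    case False
    have "inj_on f\<^sub>0 D"
      using f\<^sub>0 by (auto simp: ball_embeddings_def holomorphic_embedding_def
          biholomorphic_onto_def bij_betw_def)
    moreover have "f\<^sub>0 ` D \<subseteq> {0}" using False by auto
    ultimately have "finite D" by (metis finite.emptyI finite.insertI inj_on_finite)
    then show ?thesis by simp
  qed
  have "\<exists>f\<in>ball_embeddings D. f p = (0::'h) \<and> ball 0 (s / 2) \<subseteq> f ` D" if p: "p \<in> D" for p
  proof -
    have "s \<le> Sup (S p)" unfolding s_eq by (rule cINF_lower[OF bdd p])
    then have "s / 2 < Sup (S p)" using s by linarith
    then obtain r where r: "r \<in> S p" "s / 2 < r" using less_cSupE S_ne[OF p] by metis
    then obtain f where "f \<in> ball_embeddings D" "f p = (0::'h)" "ball 0 r \<subseteq> f ` D"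
      by (auto simp: S_def)
    moreover have "ball (0::'h) (s / 2) \<subseteq> ball 0 r" using r(2) by (intro subset_ball) simp
    ultimately show ?thesis by blast
  qed
  then show ?thesis using s by (intro exI[of _ "s / 2"]) auto
qed


section \<open>Balls of uniform size near the boundary\<close>

text \<open>Inside \<open>ball p \<rho>\<close> the set \<open>\<Omega>\<close> is open, and it is closed as well: the images of a sequence in
  \<open>\<Omega>\<close> that converges to \<open>x\<close> are Cauchy by the Lipschitz bound, with limit in \<open>ball 0 r\<close>, and
  applying the continuous inverse of \<open>f\<close> identifies \<open>x\<close> as a point of \<open>D\<close>.\<close>

lemma ball_subset_if_lipschitz:
  fixes f :: "'a::complex_normed_vector \<Rightarrow> 'h::{complex_normed_vector,complete_space}"
  assumes f: "biholomorphic_onto f D (f ` D)" "f p = 0" "ball 0 r \<subseteq> f ` D"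
    and \<Omega>: "open \<Omega>" "\<Omega> \<subseteq> D" "p \<in> \<Omega>" "D \<inter> ball p \<rho> \<inter> closure \<Omega> \<subseteq> \<Omega>"
    and lip: "\<And>x y. x \<in> \<Omega> \<inter> ball p \<rho> \<Longrightarrow> y \<in> \<Omega> \<inter> ball p \<rho> \<Longrightarrow> dist (f x) (f y) \<le> L * dist x y"
    and L: "L > 0" and \<rho>: "\<rho> > 0" "L * \<rho> \<le> r"
  shows "ball p \<rho> \<subseteq> \<Omega>"
proof -
  have "\<Omega> \<inter> ball p \<rho> = ball p \<rho>"
  proof (rule connected_eq_if_clopen)
    show "\<Omega> \<inter> ball p \<rho> \<noteq> {}" using \<Omega>(3) \<rho> by auto
    show "ball p \<rho> \<inter> closure (\<Omega> \<inter> ball p \<rho>) \<subseteq> \<Omega> \<inter> ball p \<rho>"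
    proof
      fix x assume x: "x \<in> ball p \<rho> \<inter> closure (\<Omega> \<inter> ball p \<rho>)"
      then obtain X where X: "\<And>n. X n \<in> \<Omega> \<inter> ball p \<rho>" "X \<longlonglongrightarrow> x"
        by (auto simp: closure_sequential)
      have "Cauchy (\<lambda>n. f (X n))"
      proof (rule metric_CauchyI)
        fix e :: real assume "e > 0"
        then have "e / L > 0" using L by simp
        then obtain M where M: "\<And>m n. m \<ge> M \<Longrightarrow> n \<ge> M \<Longrightarrow> dist (X m) (X n) < e / L"
          using metric_CauchyD[OF LIMSEQ_imp_Cauchy[OF X(2)]] by metis
        have "dist (f (X m)) (f (X n)) < e" if "m \<ge> M" "n \<ge> M" for m n
        proof -
          have "L * dist (X m) (X n) < e"
            using M[OF that] L by (simp add: field_simps)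
          then show ?thesis using lip[OF X(1)[of m] X(1)[of n]] by linarith
        qed
        then show "\<exists>M. \<forall>m\<ge>M. \<forall>n\<ge>M. dist (f (X m)) (f (X n)) < e" by blast
      qed
      then obtain y where y: "(\<lambda>n. f (X n)) \<longlonglongrightarrow> y"
        using Cauchy_convergent convergent_def by blast
      have "dist (f (X n)) (f p) \<le> L * dist (X n) p" for n
        using lip[OF X(1)[of n], of p] \<Omega>(3) \<rho> by simp
      then have "norm (f (X n)) \<le> L * dist (X n) p" for n
        by (simp add: f(2))
      moreover have "(\<lambda>n. norm (f (X n))) \<longlonglongrightarrow> norm y" using y by (rule tendsto_norm)
      moreover have "(\<lambda>n. L * dist (X n) p) \<longlonglongrightarrow> L * dist x p"
        by (intro tendsto_intros X(2))
      ultimately have "norm y \<le> L * dist x p"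
        by (intro LIMSEQ_le) auto
      also have "\<dots> < L * \<rho>" using x L by (simp add: dist_commute)
      finally have yin: "y \<in> f ` D" using f(3) \<rho>(2) by auto
      have "isCont (inv_into D f) y"
        using f(1) yin holomorphic_map_on_imp_isCont by (auto simp: biholomorphic_onto_def)
      then have "(\<lambda>n. inv_into D f (f (X n))) \<longlonglongrightarrow> inv_into D f y"
        using y by (rule isCont_tendsto_compose)
      moreover have "inv_into D f (f (X n)) = X n" for n
        using f(1) X(1)[of n] \<Omega>(2)
        by (auto simp: biholomorphic_onto_def bij_betw_def intro!: inv_into_f_f)
      ultimately have "x = inv_into D f y"
        using X(2) by (simp add: LIMSEQ_unique)
      then have "x \<in> D" using yin by (simp add: inv_into_into)
      moreover have "x \<in> closure \<Omega>"
        using x closure_mono[of "\<Omega> \<inter> ball p \<rho>" \<Omega>] by blast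
      ultimately show "x \<in> \<Omega> \<inter> ball p \<rho>" using x \<Omega>(4) by blast
    qed
  qed (use \<Omega> in auto)
  then show ?thesis by blast
qed

text \<open>The continuation is taken separately for each component \<open>\<langle>f x, e\<rangle>\<close>, with \<open>e\<close> in the unit ball;
  since the Lipschitz constant does not depend on \<open>e\<close>, it passes to \<open>f\<close> itself.\<close>

lemma embedding_lipschitz_if_extension:
  fixes D :: "'a::complex_normed_vector set"
    and f :: "'a \<Rightarrow> 'h::complex_inner"
  assumes ext: "\<And>f::'a \<Rightarrow> complex. f holomorphic_map_on D \<Longrightarrow>
      \<exists>g::'a \<Rightarrow> complex. g holomorphic_map_on U \<and> (\<forall>x\<in>W. g x = f x)"
    and U: "open U" "connected U" and W: "open W" "W \<subseteq> D \<inter> U"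
    and \<Omega>: "open \<Omega>" "connected \<Omega>" "\<Omega> \<subseteq> D \<inter> U" "W \<inter> \<Omega> \<noteq> {}"
    and f: "f holomorphic_map_on D" "f ` D \<subseteq> ball 0 1"
    and R: "ball p R \<subseteq> U"
    and xy: "x \<in> \<Omega> \<inter> ball p (R / 2)" "y \<in> \<Omega> \<inter> ball p (R / 2)"
  shows "dist (f x) (f y) \<le> 4 / R * dist x y"
proof -
  have "R > 0" using xy(1) le_less_trans[OF zero_le_dist, of p x "R / 2"] by simp
  have "norm (f x - f y) \<le> 4 / R * dist x y"
  proof (rule norm_le_if_cinner_le)
    fix e :: 'h assume e: "norm e \<le> 1"
    define \<phi> where "\<phi> x = cinner (f x) e" for x
    have \<phi>: "\<phi> holomorphic_map_on D"
      unfolding \<phi>_def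
      by (rule holomorphic_map_on_compose[OF f(1) holomorphic_map_on_cinner subset_UNIV])
    have \<phi>1: "cmod (\<phi> x) < 1" if "x \<in> D" for x
    proof -
      have "cmod (\<phi> x) \<le> norm (f x) * norm e"
        unfolding \<phi>_def by (rule cinner_cauchy_schwarz)
      also have "\<dots> \<le> norm (f x)" using e by (simp add: mult_left_le)
      also have "\<dots> < 1" using f(2) that by auto
      finally show ?thesis .
    qed
    obtain G where G: "G holomorphic_map_on U" "\<And>x. x \<in> W \<Longrightarrow> G x = \<phi> x"
      using ext[OF \<phi>] by blast
    have bound: "cmod (G u) < 1" if "u \<in> U" for u
      by (rule extension_bounded[OF ext U W(1) _ _ _ \<phi> \<phi>1 G that]) (use W(2) \<Omega>(4) in auto)
    have G_eq: "G z = \<phi> z" if "z \<in> \<Omega>" for z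
    proof (rule identity_theorem[OF _ _ \<Omega>(1,2) _ \<Omega>(4) _ _ that])
      show "G holomorphic_map_on \<Omega>" "\<phi> holomorphic_map_on \<Omega>"
        using G(1) \<phi> \<Omega>(3) by (auto intro: holomorphic_map_on_subset)
    qed (use W \<Omega> G(2) in auto)
    have "cmod (G x - G y) \<le> 4 / R * dist x y"
      by (rule lipschitz_half_ball[OF holomorphic_map_on_subset[OF G(1) R]])
        (use R bound xy in auto)
    then show "cmod (cinner (f x - f y) e) \<le> 4 / R * dist x y"
      using G_eq xy by (simp add: \<phi>_def cinner_diff_left)
  qed (use \<open>R > 0\<close> in simp)
  then show ?thesis by (simp add: dist_norm)
qed

theorem theorem2p5:
  fixes D :: "'v::complex_banach set"
  assumes "HHR TYPE('h::complex_hilbert) D"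
  shows "domain_of_holomorphy D"
proof -
  have D: "is_domain D" using assms by (simp add: HHR_def)
  obtain r where r: "r > 0"
    "\<And>p. p \<in> D \<Longrightarrow> \<exists>f\<in>ball_embeddings D. f p = (0::'h) \<and> ball 0 r \<subseteq> f ` D"
    using HHR_uniform_radius[OF assms] by blast
  have False if U: "open U" "connected U" and UD: "\<not> U \<subseteq> D"
    and W: "open W" "W \<noteq> {}" "W \<subseteq> D \<inter> U"
    and ext: "\<And>f::'v \<Rightarrow> complex. f holomorphic_map_on D \<Longrightarrow>
      \<exists>g::'v \<Rightarrow> complex. g holomorphic_map_on U \<and> (\<forall>x\<in>W. g x = f x)" for U W
  proof -
    obtain w where w: "w \<in> W" using W(2) by blast
    define \<Omega> where "\<Omega> = connected_component_set (D \<inter> U) w"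
    have "open (D \<inter> U)" using D U(1) by (auto simp: is_domain_def)
    moreover have "w \<in> D \<inter> U" using w W(3) by blast
    ultimately have \<Omega>: "open \<Omega>" "connected \<Omega>" "\<Omega> \<subseteq> D \<inter> U" "w \<in> \<Omega>"
      unfolding \<Omega>_def
      by (simp_all only: open_connected_component connected_connected_component
          connected_component_subset connected_component_refl mem_Collect_eq)
    obtain C where C: "closed C" "\<Omega> = D \<inter> U \<inter> C"
      using closedin_connected_component[of "D \<inter> U" w] unfolding \<Omega>_def closedin_closed by blast
    have "closure \<Omega> \<subseteq> C"
      by (rule closure_minimal[OF _ C(1)]) (simp add: C(2))
    then have \<Omega>_closed: "D \<inter> U \<inter> closure \<Omega> \<subseteq> \<Omega>"
      unfolding C(2) by blast
    have "\<not> U \<inter> closure \<Omega> \<subseteq> \<Omega>"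
      using connected_eq_if_clopen[OF U(2) \<Omega>(1)] \<Omega>(3,4) UD by blast
    then obtain q where q: "q \<in> U" "q \<in> closure \<Omega>" "q \<notin> \<Omega>" by blast
    obtain R' where R': "R' > 0" "ball q R' \<subseteq> U" using U(1) q(1) openE by blast
    define R where "R = R' / 2"
    define \<rho> where "\<rho> = min (R / 2) (r * R / 4)"
    have R: "R > 0" and \<rho>: "\<rho> > 0" "\<rho> \<le> R / 2" "4 / R * \<rho> \<le> r"
      using R' r(1) by (auto simp: R_def \<rho>_def min_def field_simps)
    obtain p where p: "p \<in> \<Omega>" "dist p q < \<rho>"
      using q(2) \<rho>(1) by (metis closure_approachable)
    have RU: "ball p R \<subseteq> U"
    proof
      fix z assume "z \<in> ball p R"
      then have "dist q z < R'"
        using p(2) \<rho>(2) R dist_triangle[of q z p] by (simp add: R_def dist_commute)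
      then show "z \<in> U" using R'(2) by auto
    qed
    obtain f where f: "f \<in> ball_embeddings D" "f p = (0::'h)" "ball 0 r \<subseteq> f ` D"
      using r(2) p(1) \<Omega>(3) by blast
    then have bi: "biholomorphic_onto f D (f ` D)" and hol: "f holomorphic_map_on D"
      and img: "f ` D \<subseteq> ball 0 1"
      by (auto simp: ball_embeddings_def holomorphic_embedding_def biholomorphic_onto_def)
    have lip: "dist (f x) (f y) \<le> 4 / R * dist x y"
      if "x \<in> \<Omega> \<inter> ball p (R / 2)" "y \<in> \<Omega> \<inter> ball p (R / 2)" for x y
      by (rule embedding_lipschitz_if_extension[OF ext U W(1,3) \<Omega>(1-3) _ hol img RU])
        (use that w \<Omega>(4) in auto)
    have sub: "ball p \<rho> \<subseteq> ball p (R / 2)" "ball p \<rho> \<subseteq> U"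
      using \<rho> R RU by auto
    have "ball p \<rho> \<subseteq> \<Omega>"
    proof (rule ball_subset_if_lipschitz[OF bi f(2,3) \<Omega>(1) _ p(1) _ _ _ \<rho>(1,3)])
      show "D \<inter> ball p \<rho> \<inter> closure \<Omega> \<subseteq> \<Omega>" using sub(2) \<Omega>_closed by blast
      show "dist (f x) (f y) \<le> 4 / R * dist x y"
        if "x \<in> \<Omega> \<inter> ball p \<rho>" "y \<in> \<Omega> \<inter> ball p \<rho>" for x y
        using that sub(1) by (intro lip) auto
    qed (use \<Omega>(3) R in auto)
    then show False using p(2) q(3) by auto
  qed
  then show ?thesis using D unfolding domain_of_holomorphy_def by blast
qed

end
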